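(* Let $H$ be a separable real Hilbert space with norm $\|\cdot\|$. Let $(\beta_{n,k})_{(n,k)\in\mathbb{N}\times\mathbb{N}}$ be a family of (deterministic, bounded) linear operators on $H$, let $(\xi_n)$ be a sequence of $H$-valued martingale differences adapted to a filtration $(\mathcal{F}_n)$, and let $(\gamma_n)$ be a sequence of positive real numbers. Then, for all $r>0$ and all $n\ge1$, $$\mathbb{P}\left[\left\|\sum_{k=1}^{n-1}\gamma_k\beta_{n-1,k}\xi_{k+1}\right\|\ge r\right]\le 2e^{-r}\left\|\prod_{j=2}^{n}\left(1+\mathbb{E}\left[e^{\|\beta_{n-1,j-1}\gamma_{j-1}\xi_j\|}-1-\|\beta_{n-1,j-1}\gamma_{j-1}\xi_j\|\,\Big|\,\mathcal{F}_{j-1}\right]\right)\right\|_{\infty}$$ $$\le 2\exp\left(-r+\left\|\sum_{j=2}^{n}\mathbb{E}\left[e^{\|\beta_{n-1,j-1}\gamma_{j-1}\xi_j\|}-1-\|\beta_{n-1,j-1}\gamma_{j-1}\xi_j\|\,\Big|\,\mathcal{F}_{j-1}\right]\right\|_{\infty}\right).$$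
   Context: $(\xi_n)$ being a martingale difference sequence adapted to $(\mathcal{F}_n)$ means that each $\xi_n$ is integrable and $\mathcal{F}_n$-measurable and $\mathbb{E}[\xi_{n+1}\mid\mathcal{F}_n]=0$. For a nonnegative real random variable $Y$, $\|Y\|_\infty\in[0,\infty]$ denotes its essential supremum. Empty sums are $0$ and empty products are $1$. *)

theory Defs
  imports "HOL-Probability.Probability"
begin

(* HOL-Probability has conditional expectations only for real and ennreal valued functions;
   for Banach space valued X we use the defining property of a version of E[X | F]. *)
definition has_cond_exp ::
    "'a measure \<Rightarrow> 'a measure \<Rightarrow> ('a \<Rightarrow> 'b::{banach, second_countable_topology}) \<Rightarrow> ('a \<Rightarrow> 'b) \<Rightarrow> bool"
  where
  "has_cond_exp M F X Y \<longleftrightarrow>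
     integrable M X \<and> integrable M Y \<and> Y \<in> borel_measurable F \<and>
     (\<forall>A\<in>sets F. (LINT \<omega>:A|M. X \<omega>) = (LINT \<omega>:A|M. Y \<omega>))"

definition martingale_difference ::
    "'a measure \<Rightarrow> (nat \<Rightarrow> 'a measure) \<Rightarrow> (nat \<Rightarrow> 'a \<Rightarrow> 'b::{banach, second_countable_topology}) \<Rightarrow> bool"
  where
  "martingale_difference M F \<xi> \<longleftrightarrow>
     (\<forall>n. integrable M (\<xi> n) \<and> \<xi> n \<in> borel_measurable (F n) \<and>
          has_cond_exp M (F n) (\<xi> (Suc n)) (\<lambda>_. 0))"

definition ereal_exp :: "ereal \<Rightarrow> ennreal" where
  "ereal_exp x = (case x of ereal t \<Rightarrow> ennreal (exp t) | PInfty \<Rightarrow> \<infinity> | MInfty \<Rightarrow> 0)"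

(* E[exp ||X|| - 1 - ||X|| | F]. The integrand is nonnegative but need not be integrable,
   so this is the [0,\<infinity>]-valued conditional expectation. *)
definition cond_exp_excess ::
    "'a measure \<Rightarrow> 'a measure \<Rightarrow> ('a \<Rightarrow> 'b::real_normed_vector) \<Rightarrow> 'a \<Rightarrow> ennreal"
  where
  "cond_exp_excess M F X = nn_cond_exp M F (\<lambda>\<omega>. ennreal (exp (norm (X \<omega>)) - 1 - norm (X \<omega>)))"

end

theory Submission
  imports Defs
begin

text \<open>
  This is an exponential tail bound of Pinelis type, and the Hilbert space structure enters
  only through one deterministic inequality (\<open>cosh_norm_add_le\<close>):
  \<open>cosh \<parallel>f + d\<parallel> \<le> cosh \<parallel>f\<parallel> (1 + x) + \<langle>g, d\<rangle>\<close>
  with \<open>x = exp \<parallel>d\<parallel> - 1 - \<parallel>d\<parallel>\<close> and a vector \<open>g\<close> that depends on \<open>f\<close> alone. So \<open>cosh \<parallel>\<sqdot>\<parallel>\<close> is a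
  smooth substitute for \<open>exp \<parallel>\<sqdot>\<parallel>\<close>: its increment is a term linear in \<open>d\<close>, plus an error
  proportional to \<open>cosh \<parallel>f\<parallel>\<close> itself.

  Now let \<open>d\<^sub>k = \<beta>\<^bsub>n-1,k\<^esub> (\<gamma>\<^sub>k \<xi>\<^bsub>k+1\<^esub>)\<close>, let \<open>S\<^sub>m\<close> be the sum of \<open>d\<^sub>1, \<dots>, d\<^sub>m\<close>, let \<open>e\<^sub>k\<close> be the
  conditional expectation of the excess of \<open>d\<^sub>k\<close> given \<open>F\<^sub>k\<close>, and let \<open>P\<^sub>m\<close> be the product of
  the \<open>1 + e\<^sub>k\<close>. Conditionally on \<open>F\<^sub>m\<close> the linear term has mean zero
  (\<open>has_cond_exp_zero_inner\<close>) and the error term has mean \<open>cosh \<parallel>S\<^bsub>m-1\<^esub>\<parallel> e\<^sub>m\<close>; hence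
  \<open>cosh \<parallel>S\<^sub>m\<parallel> / P\<^sub>m\<close> is a supermartingale started at \<open>1\<close>, and its expectation is at most \<open>1\<close>
  (\<open>nn_integral_cosh_norm_martingale_le_1\<close>). Since \<open>P\<^sub>m\<close> is almost surely at most its
  essential supremum, and since \<open>cosh \<parallel>S\<^sub>m\<parallel> \<ge> exp r / 2\<close> wherever \<open>\<parallel>S\<^sub>m\<parallel> \<ge> r\<close>, Markov's
  inequality gives the first bound. The second one follows from \<open>1 + e \<le> exp e\<close>.

  The conditional excess may be infinite. This is harmless because the weight \<open>1 / P\<^sub>m\<close>
  vanishes there, and because the bound on the previous expectation supplies the
  integrability of the weighted linear term.
\<close>

section \<open>Smoothness of the hyperbolic cosine of the norm\<close>

lemma le_sinh:
  fixes x :: real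
  assumes "0 \<le> x"
  shows "x \<le> sinh x"
proof -
  have "(\<lambda>x::real. sinh x - x) 0 \<le> (\<lambda>x. sinh x - x) x"
    by (rule DERIV_nonneg_imp_nondecreasing[OF assms])
       (auto intro!: exI derivative_eq_intros cosh_real_ge_1)
  then show ?thesis by simp
qed

lemma two_times_le_exp:
  fixes x :: real
  assumes "0 \<le> x"
  shows "2 * x \<le> exp x"
proof -
  have "1 + x + x\<^sup>2 / 2 \<le> exp x"
    using assms by (rule exp_lower_Taylor_quadratic)
  moreover have "0 \<le> (x - 1)\<^sup>2" by simp
  ultimately show ?thesis by (simp add: power2_diff)
qed

text \<open>
  The function \<open>s \<mapsto> cosh (sqrt s)\<close> is convex on the half-line, since it is a power series in \<open>s\<close>
  with nonnegative coefficients; here this is expressed in terms of the square roots.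
\<close>
lemma cosh_le_convex_combination:
  fixes x y z t :: real
  assumes z: "z\<^sup>2 = (1 - t) * x\<^sup>2 + t * y\<^sup>2" and t: "0 \<le> t" "t \<le> 1"
  shows "cosh z \<le> (1 - t) * cosh x + t * cosh y"
proof -
  define c where "c = (\<lambda>(x::real) n. if even n then x ^ n /\<^sub>R fact n else 0)"
  have sums: "c u sums cosh u" for u
    unfolding c_def by (rule cosh_converges)
  have le: "c z n \<le> (1 - t) * c x n + t * c y n" for n
  proof (cases "even n")
    case True
    then obtain k where n: "n = 2 * k" by blast
    have "convex_on {0..} (\<lambda>s::real. s ^ k)"
      by (rule convex_on_realI[where f' = "\<lambda>s. real k * s ^ (k - 1)"])
         (auto intro!: derivative_eq_intros mult_left_mono power_mono)
    from convex_onD[OF this t, of "x\<^sup>2" "y\<^sup>2"]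
    have "(z\<^sup>2) ^ k \<le> (1 - t) * (x\<^sup>2) ^ k + t * (y\<^sup>2) ^ k"
      by (simp add: z)
    then have "z ^ n / fact n \<le> ((1 - t) * x ^ n + t * y ^ n) / fact n"
      unfolding n power_mult by (rule divide_right_mono) simp
    then show ?thesis
      using True by (simp add: c_def field_simps)
  qed (simp add: c_def)
  have "(\<lambda>n. (1 - t) * c x n + t * c y n) sums ((1 - t) * cosh x + t * cosh y)"
    by (intro sums_add sums_mult sums)
  from sums_le[OF le sums this] show ?thesis .
qed

text \<open>
  For fixed norms \<open>a\<close> of \<open>f\<close> and \<open>b\<close> of \<open>d\<close>, the left side is a convex function of the inner product,
  because \<open>\<parallel>f + d\<parallel>\<^sup>2\<close> is affine in it, and the right side is affine. So only the extreme
  values \<open>\<plusminus> a b\<close> matter, where \<open>f\<close> and \<open>d\<close> are parallel and the addition theorem for \<open>cosh\<close>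
  reduces the claim to \<open>\<bar>sinh a\<bar> \<le> cosh a\<close> and \<open>b \<le> sinh b\<close>. The linear term is the derivative of
  \<open>cosh \<parallel>\<sqdot>\<parallel>\<close> at \<open>f\<close> in direction \<open>d\<close>; it is \<open>0\<close> at \<open>f = 0\<close>, in agreement with division by zero.
\<close>
lemma cosh_norm_add_le:
  fixes f d :: "'h::real_inner"
  shows "cosh (norm (f + d)) \<le> cosh (norm f) * (exp (norm d) - norm d)
           + ((sinh (norm f) / norm f) *\<^sub>R f) \<bullet> d"
proof -
  define a where "a = norm f"
  define b where "b = norm d"
  have ab: "0 \<le> a" "0 \<le> b" by (auto simp: a_def b_def)
  have cs: "\<bar>f \<bullet> d\<bar> \<le> a * b"
    unfolding a_def b_def by (rule Cauchy_Schwarz_ineq2)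
  obtain s where s: "\<bar>s\<bar> \<le> 1" "f \<bullet> d = s * (a * b)"
  proof (cases "a * b = 0")
    case True
    with cs show ?thesis by (intro that[of 0]) auto
  next
    case False
    with ab have "0 < a * b" by (simp add: less_le)
    with cs show ?thesis by (intro that[of "f \<bullet> d / (a * b)"]) auto
  qed
  \<comment> \<open>The position of the inner product between the extremes \<open>- a b\<close> and \<open>a b\<close>.\<close>
  define t where "t = (1 + s) / 2"
  have t: "0 \<le> t" "t \<le> 1" using s by (auto simp: t_def)
  have "(norm (f + d))\<^sup>2 = a\<^sup>2 + b\<^sup>2 + 2 * (f \<bullet> d)"
    unfolding a_def b_def power2_norm_eq_inner
    by (simp add: inner_add_left inner_add_right inner_commute)
  also have "\<dots> = (1 - t) * (a - b)\<^sup>2 + t * (a + b)\<^sup>2"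
    unfolding s t_def by (simp add: power2_eq_square field_simps)
  finally have "cosh (norm (f + d)) \<le> (1 - t) * cosh (a - b) + t * cosh (a + b)"
    using t by (rule cosh_le_convex_combination)
  also have "\<dots> = cosh a * cosh b + s * sinh a * sinh b"
    by (simp add: t_def cosh_add cosh_diff field_simps)
  also have "\<dots> \<le> cosh a * (exp b - b) + s * sinh a * b"
  proof -
    have "s * sinh a \<le> 1 * cosh a"
    proof (rule order_trans)
      show "s * sinh a \<le> 1 * sinh a"
        using s ab by (intro mult_right_mono) auto
      show "1 * sinh a \<le> 1 * cosh a"
        by (simp add: sinh_le_cosh_real)
    qed
    then have "s * sinh a * (sinh b - b) \<le> cosh a * (sinh b - b)"
      using le_sinh[OF ab(2)] by (intro mult_right_mono) auto
    then show ?thesis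
      by (simp add: cosh_plus_sinh[symmetric] algebra_simps)
  qed
  also have "s * sinh a * b = ((sinh a / a) *\<^sub>R f) \<bullet> d"
    using s by (cases "a = 0") auto
  finally show ?thesis by (simp add: a_def b_def)
qed

section \<open>Conditionally centred vectors against predictable test vectors\<close>

lemma has_cond_exp_zero_inner_simple:
  fixes X :: "'a \<Rightarrow> 'h::{real_inner, banach, second_countable_topology}"
  assumes sub: "subalgebra M F" and X: "has_cond_exp M F X (\<lambda>_. 0)"
    and s: "simple_function F s"
  shows "integrable M (\<lambda>\<omega>. s \<omega> \<bullet> X \<omega>)" "(\<integral>\<omega>. s \<omega> \<bullet> X \<omega> \<partial>M) = 0"
proof -
  have space: "space F = space M" and sets: "sets F \<subseteq> sets M"
    using sub by (auto simp: subalgebra_def)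
  have int: "integrable M X" and zero: "\<And>A. A \<in> sets F \<Longrightarrow> (LINT \<omega>:A|M. X \<omega>) = 0"
    using X by (auto simp: has_cond_exp_def set_lebesgue_integral_def)
  define A where "A y = s -` {y} \<inter> space M" for y
  have A: "A y \<in> sets F" for y
    using simple_functionD(2)[OF s] by (simp add: A_def space)
  have fin: "finite (s ` space M)"
    using simple_functionD(1)[OF s] by (simp add: space)
  have "s \<omega> \<bullet> X \<omega> = (\<Sum>y\<in>s ` space M. y \<bullet> (indicator (A y) \<omega> *\<^sub>R X \<omega>))"
    if "\<omega> \<in> space M" for \<omega>
  proof -
    have "(\<Sum>y\<in>s ` space M. y \<bullet> (indicator (A y) \<omega> *\<^sub>R X \<omega>))
        = (\<Sum>y\<in>s ` space M. if y = s \<omega> then s \<omega> \<bullet> X \<omega> else 0)"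
      using that by (intro sum.cong) (auto simp: A_def indicator_def)
    with that fin show ?thesis by simp
  qed
  note eq = this
  have int_ind: "integrable M (\<lambda>\<omega>. indicator (A y) \<omega> *\<^sub>R X \<omega>)" for y
    using A sets int by (intro integrable_mult_indicator) auto
  have int_y: "integrable M (\<lambda>\<omega>. y \<bullet> (indicator (A y) \<omega> *\<^sub>R X \<omega>))" for y
    by (intro integrable_inner_right int_ind)
  show "integrable M (\<lambda>\<omega>. s \<omega> \<bullet> X \<omega>)"
    using Bochner_Integration.integrable_sum[OF int_y]
    by (simp only: eq cong: Bochner_Integration.integrable_cong)
  have "(\<integral>\<omega>. s \<omega> \<bullet> X \<omega> \<partial>M)
      = (\<integral>\<omega>. (\<Sum>y\<in>s ` space M. y \<bullet> (indicator (A y) \<omega> *\<^sub>R X \<omega>)) \<partial>M)"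
    by (intro Bochner_Integration.integral_cong refl eq)
  also have "\<dots> = (\<Sum>y\<in>s ` space M. y \<bullet> (\<integral>\<omega>. indicator (A y) \<omega> *\<^sub>R X \<omega> \<partial>M))"
    by (simp only: Bochner_Integration.integral_sum[OF int_y] integral_inner_right[OF int_ind])
  also have "\<dots> = 0"
    using zero[OF A] by (simp add: set_lebesgue_integral_def)
  finally show "(\<integral>\<omega>. s \<omega> \<bullet> X \<omega> \<partial>M) = 0" .
qed

text \<open>
  The defining property of a vanishing conditional expectation extends from indicators to
  simple functions by linearity, and from there to \<open>G\<close> by dominated convergence. The
  hypothesis on the product of the norms is the form in which the weighted supermartingale
  step controls the linear term.
\<close>
lemma has_cond_exp_zero_inner:
  fixes X :: "'a \<Rightarrow> 'h::{real_inner, banach, second_countable_topology}"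
  assumes sub: "subalgebra M F" and X: "has_cond_exp M F X (\<lambda>_. 0)"
    and G: "G \<in> borel_measurable F"
    and GX: "integrable M (\<lambda>\<omega>. norm (G \<omega>) * norm (X \<omega>))"
  shows "integrable M (\<lambda>\<omega>. G \<omega> \<bullet> X \<omega>)" "(\<integral>\<omega>. G \<omega> \<bullet> X \<omega> \<partial>M) = 0"
proof -
  have space: "space F = space M"
    using sub by (auto simp: subalgebra_def)
  have [measurable]: "X \<in> borel_measurable M"
    using X by (auto simp: has_cond_exp_def)
  have [measurable]: "G \<in> borel_measurable M"
    using sub G by (rule measurable_from_subalg)
  show "integrable M (\<lambda>\<omega>. G \<omega> \<bullet> X \<omega>)"
    by (rule Bochner_Integration.integrable_bound[OF GX])
       (auto simp: Cauchy_Schwarz_ineq2)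
  from borel_measurable_implies_sequence_metric[OF G, of 0] obtain s where
    s: "\<And>i. simple_function F (s i)"
    and lim: "\<And>\<omega>. \<omega> \<in> space M \<Longrightarrow> (\<lambda>i. s i \<omega>) \<longlonglongrightarrow> G \<omega>"
    and bound: "\<And>i \<omega>. \<omega> \<in> space M \<Longrightarrow> norm (s i \<omega>) \<le> 2 * norm (G \<omega>)"
    by (simp add: space) metis
  have [measurable]: "s i \<in> borel_measurable M" for i
    by (rule measurable_from_subalg[OF sub borel_measurable_simple_function[OF s]])
  have "(\<lambda>i. \<integral>\<omega>. s i \<omega> \<bullet> X \<omega> \<partial>M) \<longlonglongrightarrow> (\<integral>\<omega>. G \<omega> \<bullet> X \<omega> \<partial>M)"
  proof (rule integral_dominated_convergence)
    show "integrable M (\<lambda>\<omega>. 2 * (norm (G \<omega>) * norm (X \<omega>)))"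
      using GX by simp
    show "AE \<omega> in M. (\<lambda>i. s i \<omega> \<bullet> X \<omega>) \<longlonglongrightarrow> G \<omega> \<bullet> X \<omega>"
      by (auto intro!: tendsto_inner lim)
    show "AE \<omega> in M. norm (s i \<omega> \<bullet> X \<omega>) \<le> 2 * (norm (G \<omega>) * norm (X \<omega>))" for i
    proof (rule AE_I2)
      fix \<omega> assume "\<omega> \<in> space M"
      have "norm (s i \<omega> \<bullet> X \<omega>) \<le> norm (s i \<omega>) * norm (X \<omega>)"
        by (simp add: Cauchy_Schwarz_ineq2)
      also have "\<dots> \<le> 2 * norm (G \<omega>) * norm (X \<omega>)"
        using bound[OF \<open>\<omega> \<in> space M\<close>] by (rule mult_right_mono) simp
      finally show "norm (s i \<omega> \<bullet> X \<omega>) \<le> 2 * (norm (G \<omega>) * norm (X \<omega>))" by simp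
    qed
  qed auto
  then show "(\<integral>\<omega>. G \<omega> \<bullet> X \<omega> \<partial>M) = 0"
    unfolding has_cond_exp_zero_inner_simple(2)[OF sub X s] by (simp add: LIMSEQ_const_iff)
qed

lemma has_cond_exp_zero_bounded_linear:
  assumes L: "bounded_linear L" and X: "has_cond_exp M F X (\<lambda>_. 0)" and sub: "subalgebra M F"
  shows "has_cond_exp M F (\<lambda>\<omega>. L (X \<omega>)) (\<lambda>_. 0)"
proof -
  interpret L: bounded_linear L by fact
  have int: "integrable M X" using X by (simp add: has_cond_exp_def)
  have "(LINT \<omega>:A|M. L (X \<omega>)) = 0" if A: "A \<in> sets F" for A
  proof -
    have A': "A \<in> sets M" using A sub by (auto simp: subalgebra_def)
    have "(LINT \<omega>:A|M. L (X \<omega>)) = (\<integral>\<omega>. L (indicator A \<omega> *\<^sub>R X \<omega>) \<partial>M)"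
      by (simp add: set_lebesgue_integral_def L.scaleR)
    also have "\<dots> = L (LINT \<omega>:A|M. X \<omega>)"
      unfolding set_lebesgue_integral_def
      by (intro integral_bounded_linear L integrable_mult_indicator A' int)
    also have "(LINT \<omega>:A|M. X \<omega>) = 0"
      using X A by (simp add: has_cond_exp_def set_lebesgue_integral_def)
    finally show ?thesis by (simp add: L.zero)
  qed
  then show ?thesis
    using integrable_bounded_linear[OF L int]
    by (simp add: has_cond_exp_def set_lebesgue_integral_def)
qed

section \<open>The exponential supermartingale\<close>

text \<open>
  The case distinction on the integrability of \<open>v\<close> makes it possible to drop a centred term \<open>c\<close>
  from an upper bound whose integral may be infinite; if it is infinite the
  claim is trivial, and otherwise domination by \<open>v\<close> is the way to see that \<open>c\<close> is integrable.
\<close>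
lemma nn_integral_le_of_integral_zero:
  fixes u v c :: "'a \<Rightarrow> real"
  assumes v: "v \<in> borel_measurable M" "\<And>\<omega>. 0 \<le> v \<omega>"
    and u: "\<And>\<omega>. 0 \<le> u \<omega>"
    and le: "\<And>\<omega>. u \<omega> \<le> v \<omega> + c \<omega>"
    and c: "integrable M v \<Longrightarrow> integrable M c" "integrable M v \<Longrightarrow> (\<integral>\<omega>. c \<omega> \<partial>M) = 0"
  shows "(\<integral>\<^sup>+\<omega>. ennreal (u \<omega>) \<partial>M) \<le> (\<integral>\<^sup>+\<omega>. ennreal (v \<omega>) \<partial>M)"
proof (cases "integrable M v")
  case True
  have "(\<integral>\<^sup>+\<omega>. ennreal (u \<omega>) \<partial>M) \<le> (\<integral>\<^sup>+\<omega>. ennreal (v \<omega> + c \<omega>) \<partial>M)"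
    by (intro nn_integral_mono ennreal_leI le)
  also have "\<dots> = ennreal (\<integral>\<omega>. v \<omega> + c \<omega> \<partial>M)"
    using True c u le by (intro nn_integral_eq_integral) (auto intro: order_trans)
  also have "\<dots> = ennreal (\<integral>\<omega>. v \<omega> \<partial>M)"
    using True c by simp
  also have "\<dots> = (\<integral>\<^sup>+\<omega>. ennreal (v \<omega>) \<partial>M)"
    using True v by (intro nn_integral_eq_integral[symmetric]) auto
  finally show ?thesis .
next
  case False
  with v have "(\<integral>\<^sup>+\<omega>. ennreal (v \<omega>) \<partial>M) = \<infinity>"
    by (simp add: integrable_iff_bounded less_top[symmetric])
  then show ?thesis by simp
qed

text \<open>
  One step of the supermartingale: integrate the deterministic inequality against a weight \<open>w\<close>
  that is known before \<open>d\<close> is revealed. The linear term integrates to zero; it is dominated by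
  the main term because \<open>sinh \<le> cosh\<close> and \<open>\<parallel>d\<parallel> \<le> exp \<parallel>d\<parallel> - \<parallel>d\<parallel>\<close>, so it is integrable
  whenever the right side is finite.
\<close>
lemma (in sigma_finite_subalgebra) nn_integral_cosh_norm_add_le:
  fixes f d :: "'a \<Rightarrow> 'h::{real_inner, banach, second_countable_topology}"
    and w :: "'a \<Rightarrow> ennreal"
  assumes f: "f \<in> borel_measurable F" and w: "w \<in> borel_measurable F" "\<And>\<omega>. w \<omega> < \<infinity>"
    and d: "has_cond_exp M F d (\<lambda>_. 0)"
  shows "(\<integral>\<^sup>+\<omega>. ennreal (cosh (norm (f \<omega> + d \<omega>))) * w \<omega> \<partial>M)
      \<le> (\<integral>\<^sup>+\<omega>. ennreal (cosh (norm (f \<omega>))) * (w \<omega> * (1 + cond_exp_excess M F d \<omega>)) \<partial>M)"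
proof -
  have [measurable]: "d \<in> borel_measurable M"
    using d by (auto simp: has_cond_exp_def)
  note [measurable] = f w
  have [measurable]: "f \<in> borel_measurable M" "w \<in> borel_measurable M"
    using f w(1) by (auto intro: measurable_from_subalg[OF subalg])
  define r where "r \<omega> = enn2real (w \<omega>)" for \<omega>
  have [measurable]: "r \<in> borel_measurable F" "r \<in> borel_measurable M"
    unfolding r_def by measurable
  have w_r: "w \<omega> = ennreal (r \<omega>)" and r0: "0 \<le> r \<omega>" for \<omega>
    using w(2)[of \<omega>] by (auto simp: r_def)
  define x where "x \<omega> = exp (norm (d \<omega>)) - 1 - norm (d \<omega>)" for \<omega>
  have [measurable]: "x \<in> borel_measurable M" unfolding x_def by measurable
  have x0: "0 \<le> x \<omega>" for \<omega>
    using exp_ge_add_one_self[of "norm (d \<omega>)"] unfolding x_def by linarith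
  define v where "v \<omega> = r \<omega> * cosh (norm (f \<omega>)) * (1 + x \<omega>)" for \<omega>
  \<comment> \<open>The coefficient vector of the linear term in \<open>cosh_norm_add_le\<close>, with the weight absorbed.\<close>
  define G where "G \<omega> = r \<omega> *\<^sub>R (sinh (norm (f \<omega>)) / norm (f \<omega>)) *\<^sub>R f \<omega>" for \<omega>
  have [measurable]: "G \<in> borel_measurable F" unfolding G_def sinh_field_def by measurable
  then have [measurable]: "G \<in> borel_measurable M"
    by (rule measurable_from_subalg[OF subalg])
  have [measurable]: "v \<in> borel_measurable M" unfolding v_def cosh_field_def by measurable
  have Gd: "norm (G \<omega>) * norm (d \<omega>) \<le> v \<omega>" for \<omega>
  proof -
    have "norm (G \<omega>) \<le> r \<omega> * sinh (norm (f \<omega>))"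
      using r0[of \<omega>] by (auto simp: G_def abs_mult)
    also have "\<dots> \<le> r \<omega> * cosh (norm (f \<omega>))"
      using r0 by (intro mult_left_mono) (auto simp: sinh_le_cosh_real)
    finally show ?thesis
      using two_times_le_exp[of "norm (d \<omega>)"] r0[of \<omega>] unfolding v_def
      by (intro mult_mono) (auto simp: x_def)
  qed
  have "(\<integral>\<^sup>+\<omega>. ennreal (cosh (norm (f \<omega> + d \<omega>))) * w \<omega> \<partial>M)
      = (\<integral>\<^sup>+\<omega>. ennreal (r \<omega> * cosh (norm (f \<omega> + d \<omega>))) \<partial>M)"
    using r0 by (simp add: w_r ennreal_mult'' mult.commute)
  also have "\<dots> \<le> (\<integral>\<^sup>+\<omega>. ennreal (v \<omega>) \<partial>M)"
  proof (rule nn_integral_le_of_integral_zero)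
    show "r \<omega> * cosh (norm (f \<omega> + d \<omega>)) \<le> v \<omega> + G \<omega> \<bullet> d \<omega>" for \<omega>
      using mult_left_mono[OF cosh_norm_add_le[of "f \<omega>" "d \<omega>"] r0[of \<omega>]]
      by (simp add: v_def G_def x_def algebra_simps)
    fix \<omega> show "0 \<le> v \<omega>" using r0 x0 by (simp add: v_def)
  next
    assume v: "integrable M v"
    have "integrable M (\<lambda>\<omega>. norm (G \<omega>) * norm (d \<omega>))"
      by (rule Bochner_Integration.integrable_bound[OF v])
         (auto intro!: AE_I2 order_trans[OF Gd])
    then show "integrable M (\<lambda>\<omega>. G \<omega> \<bullet> d \<omega>)" "(\<integral>\<omega>. G \<omega> \<bullet> d \<omega> \<partial>M) = 0"
      by (auto intro!: has_cond_exp_zero_inner[OF subalg d])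
  qed (use r0 in auto)
  also have "\<dots> = (\<integral>\<^sup>+\<omega>. ennreal (r \<omega> * cosh (norm (f \<omega>)))
        + ennreal (r \<omega> * cosh (norm (f \<omega>))) * ennreal (x \<omega>) \<partial>M)"
    using r0 x0 by (simp add: v_def distrib_left ennreal_plus ennreal_mult'')
  also have "\<dots> = (\<integral>\<^sup>+\<omega>. ennreal (r \<omega> * cosh (norm (f \<omega>))) \<partial>M)
        + (\<integral>\<^sup>+\<omega>. ennreal (r \<omega> * cosh (norm (f \<omega>))) * ennreal (x \<omega>) \<partial>M)"
    unfolding cosh_field_def by (intro nn_integral_add) measurable
  also have "(\<integral>\<^sup>+\<omega>. ennreal (r \<omega> * cosh (norm (f \<omega>))) * ennreal (x \<omega>) \<partial>M)
      = (\<integral>\<^sup>+\<omega>. ennreal (r \<omega> * cosh (norm (f \<omega>))) * cond_exp_excess M F d \<omega> \<partial>M)"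
    unfolding cond_exp_excess_def x_def[symmetric] cosh_field_def
    by (intro nn_cond_exp_intg[symmetric]) measurable
  also have "(\<integral>\<^sup>+\<omega>. ennreal (r \<omega> * cosh (norm (f \<omega>))) \<partial>M) + \<dots>
      = (\<integral>\<^sup>+\<omega>. ennreal (r \<omega> * cosh (norm (f \<omega>)))
        + ennreal (r \<omega> * cosh (norm (f \<omega>))) * cond_exp_excess M F d \<omega> \<partial>M)"
    unfolding cosh_field_def cond_exp_excess_def
    by (intro nn_integral_add[symmetric]) measurable
  also have "\<dots> = (\<integral>\<^sup>+\<omega>. ennreal (cosh (norm (f \<omega>))) * (w \<omega> * (1 + cond_exp_excess M F d \<omega>)) \<partial>M)"
    using r0 by (simp add: w_r ennreal_mult'' distrib_left mult_ac)
  finally show ?thesis .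
qed

lemma cond_exp_excess_measurable [measurable]:
  "cond_exp_excess M F X \<in> borel_measurable F"
  unfolding cond_exp_excess_def by (rule borel_measurable_nn_cond_exp)

lemma one_le_prod_one_plus_ennreal: "1 \<le> (\<Prod>k\<in>A. 1 + e k :: ennreal)"
  by (induction A rule: infinite_finite_induct)
     (auto intro: order_trans[OF _ mult_mono[of 1 _ 1]])

lemma inverse_antimono_ennreal:
  fixes a b :: ennreal
  assumes "a \<le> b"
  shows "inverse b \<le> inverse a"
  using assms including ennreal.lifting by transfer (rule ereal_inverse_antimono)

text \<open>
  Equality holds for finite \<open>b\<close>. For \<open>b = \<infinity>\<close> the left side is \<open>0\<close>, which is how the infinite
  values of the conditional excess drop out of the supermartingale.
\<close>
lemma inverse_mult_mult_le_inverse_ennreal: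
  fixes a b :: ennreal
  assumes "1 \<le> a" "1 \<le> b"
  shows "inverse (a * b) * b \<le> inverse a"
proof -
  have pos: "0 < a" "0 < b" using assms by (auto intro: less_le_trans[OF zero_less_one])
  have "inverse (a * b) = inverse a * inverse b"
    by (rule ennreal_inverse_mult') (use pos in auto)
  moreover have "inverse b * b \<le> 1"
    using pos by (cases "b = top")
      (auto simp: mult.commute ennreal_divide_self less_top divide_ennreal_def[symmetric])
  ultimately show ?thesis
    using mult_left_mono[of "inverse b * b" 1 "inverse a"] by (simp add: mult.assoc)
qed

text \<open>
  The weight at time \<open>Suc m\<close> contains \<open>e (Suc m)\<close>, which is already known at time \<open>Suc m\<close>, whereas
  \<open>d (Suc m)\<close> is only revealed one time step later. The one-step bound therefore applies with
  this weight, and it produces exactly the factor that the weight cancels.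
\<close>
lemma nn_integral_cosh_norm_martingale_le_1:
  fixes d :: "nat \<Rightarrow> 'a \<Rightarrow> 'h::{real_inner, banach, second_countable_topology}"
  assumes "prob_space M" and filt: "filtration (space M) F" and sub: "\<And>i. subalgebra M (F i)"
    and d_meas: "\<And>k. d k \<in> borel_measurable (F (Suc k))"
    and d: "\<And>k. has_cond_exp M (F k) (d k) (\<lambda>_. 0)"
  shows "(\<integral>\<^sup>+\<omega>. ennreal (cosh (norm (\<Sum>k=1..m. d k \<omega>)))
            * inverse (\<Prod>k=1..m. 1 + cond_exp_excess M (F k) (d k) \<omega>) \<partial>M) \<le> 1"
proof (induction m)
  case 0
  interpret prob_space M by fact
  show ?case by (simp add: emeasure_space_1)
next
  case (Suc m)
  interpret prob_space M by fact
  interpret sub: finite_measure_subalgebra M "F (Suc m)"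
    by unfold_locales (rule sub)
  define e where "e k = cond_exp_excess M (F k) (d k)" for k
  have mono: "subalgebra (F j) (F i)" if "i \<le> j" for i j
    using filtration.sets_F_mono[OF filt that] filtration.space_F[OF filt]
    by (auto simp: subalgebra_def)
  have [measurable]: "e k \<in> borel_measurable (F (Suc m))" if "k \<le> Suc m" for k
    using mono[OF that] unfolding e_def by (rule measurable_from_subalg) measurable
  have [measurable]: "d k \<in> borel_measurable (F (Suc m))" if "k \<le> m" for k
    using mono[of "Suc k" "Suc m"] that measurable_from_subalg[OF _ d_meas] by simp
  have f: "(\<lambda>\<omega>. \<Sum>k=1..m. d k \<omega>) \<in> borel_measurable (F (Suc m))"
    by measurable
  have w: "(\<lambda>\<omega>. inverse (\<Prod>k=1..Suc m. 1 + e k \<omega>)) \<in> borel_measurable (F (Suc m))"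
    by measurable
  have "(\<integral>\<^sup>+\<omega>. ennreal (cosh (norm (\<Sum>k=1..Suc m. d k \<omega>)))
            * inverse (\<Prod>k=1..Suc m. 1 + e k \<omega>) \<partial>M)
      = (\<integral>\<^sup>+\<omega>. ennreal (cosh (norm ((\<Sum>k=1..m. d k \<omega>) + d (Suc m) \<omega>)))
            * inverse (\<Prod>k=1..Suc m. 1 + e k \<omega>) \<partial>M)"
    by simp
  also have "\<dots> \<le> (\<integral>\<^sup>+\<omega>. ennreal (cosh (norm (\<Sum>k=1..m. d k \<omega>)))
            * (inverse (\<Prod>k=1..Suc m. 1 + e k \<omega>) * (1 + e (Suc m) \<omega>)) \<partial>M)"
    unfolding e_def[of "Suc m"]
  proof (rule sub.nn_integral_cosh_norm_add_le[OF f w _ d])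
    fix \<omega>
    have "(\<Prod>k=1..Suc m. 1 + e k \<omega>) \<noteq> 0"
      using one_le_prod_one_plus_ennreal[of "\<lambda>k. e k \<omega>" "{1..Suc m}"] by auto
    then show "inverse (\<Prod>k=1..Suc m. 1 + e k \<omega>) < \<infinity>"
      by (metis ennreal_inverse_eq_top_iff infinity_ennreal_def less_top)
  qed
  also have "\<dots> \<le> (\<integral>\<^sup>+\<omega>. ennreal (cosh (norm (\<Sum>k=1..m. d k \<omega>)))
            * inverse (\<Prod>k=1..m. 1 + e k \<omega>) \<partial>M)"
    by (intro nn_integral_mono mult_left_mono)
       (auto intro!: inverse_mult_mult_le_inverse_ennreal one_le_prod_one_plus_ennreal)
  also have "\<dots> \<le> 1"
    using Suc.IH by (simp add: e_def)
  finally show ?case by (simp add: e_def)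
qed

text \<open>
  Markov's inequality for \<open>cosh \<parallel>S\<parallel> / P\<close>, where \<open>P\<close> is almost surely at most its essential supremum
  \<open>K\<close>. The factor 2 is the price for passing from \<open>exp\<close> to \<open>cosh\<close>. If \<open>K\<close> is infinite the bound
  is trivial; that \<open>K \<ge> 1\<close> excludes the other degenerate value of \<open>inverse K\<close>.
\<close>
lemma norm_martingale_tail_le:
  fixes d :: "nat \<Rightarrow> 'a \<Rightarrow> 'h::{real_inner, banach, second_countable_topology}"
  assumes prob: "prob_space M" and filt: "filtration (space M) F"
    and sub: "\<And>i. subalgebra M (F i)"
    and d_meas: "\<And>k. d k \<in> borel_measurable (F (Suc k))"
    and d: "\<And>k. has_cond_exp M (F k) (d k) (\<lambda>_. 0)"
  shows "ennreal (measure M {\<omega> \<in> space M. r \<le> norm (\<Sum>k=1..m. d k \<omega>)})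
    \<le> 2 * ennreal (exp (- r)) * esssup M (\<lambda>\<omega>. \<Prod>k=1..m. 1 + cond_exp_excess M (F k) (d k) \<omega>)"
proof -
  interpret prob_space M by fact
  define S where "S \<omega> = (\<Sum>k=1..m. d k \<omega>)" for \<omega>
  define P where "P \<omega> = (\<Prod>k=1..m. 1 + cond_exp_excess M (F k) (d k) \<omega>)" for \<omega>
  define A where "A = {\<omega> \<in> space M. r \<le> norm (S \<omega>)}"
  define K where "K = esssup M P"
  have [measurable]: "d k \<in> borel_measurable M" for k
    using d[of k] by (auto simp: has_cond_exp_def)
  have [measurable]: "S \<in> borel_measurable M" unfolding S_def by measurable
  have [measurable]: "A \<in> sets M" unfolding A_def by measurable
  have P_le: "AE \<omega> in M. P \<omega> \<le> K"
    unfolding K_def by (rule esssup_AE)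
  have "AE \<omega> in M. 1 \<le> K"
    using P_le by eventually_elim (auto simp: P_def intro: order_trans[OF one_le_prod_one_plus_ennreal])
  then have K: "1 \<le> K" by simp
  have "ennreal (exp r / 2) * inverse K * emeasure M A
      = (\<integral>\<^sup>+\<omega>. ennreal (exp r / 2) * inverse K * indicator A \<omega> \<partial>M)"
    by (simp add: nn_integral_cmult_indicator)
  also have "\<dots> \<le> (\<integral>\<^sup>+\<omega>. ennreal (cosh (norm (S \<omega>))) * inverse (P \<omega>) \<partial>M)"
  proof (rule nn_integral_mono_AE)
    show "AE \<omega> in M. ennreal (exp r / 2) * inverse K * indicator A \<omega>
        \<le> ennreal (cosh (norm (S \<omega>))) * inverse (P \<omega>)"
      using P_le
    proof eventually_elim
      case (elim \<omega>)
      have "exp r / 2 \<le> cosh (norm (S \<omega>))" if "\<omega> \<in> A"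
      proof -
        have "exp r \<le> exp (norm (S \<omega>))" using that by (simp add: A_def)
        moreover have "exp u / 2 \<le> cosh u" for u :: real
          by (simp add: cosh_field_def)
        ultimately show ?thesis by (meson divide_right_mono order_trans zero_le_numeral)
      qed
      moreover have "inverse K \<le> inverse (P \<omega>)"
        using elim by (rule inverse_antimono_ennreal)
      ultimately show ?case
        by (auto simp: indicator_def intro!: mult_mono ennreal_leI)
    qed
  qed
  also have "\<dots> \<le> 1"
    unfolding S_def P_def
    by (rule nn_integral_cosh_norm_martingale_le_1[OF prob filt sub d_meas d])
  finally have main: "ennreal (exp r / 2) * inverse K * emeasure M A \<le> 1" .
  have "emeasure M A \<le> 2 * ennreal (exp (- r)) * K"
  proof (cases "K = top")
    case True
    then show ?thesis by (simp add: ennreal_mult_top)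
  next
    case False
    obtain K' where K': "K = ennreal K'" "1 \<le> K'"
      using False K by (cases K) auto
    have "ennreal (exp r / 2 * inverse K' * measure M A) \<le> 1"
      using main K' by (simp add: emeasure_eq_measure ennreal_mult'' inverse_ennreal ennreal_mult[symmetric])
    then have "exp r / 2 * inverse K' * measure M A \<le> 1"
      by (metis ennreal_le_1)
    then have "measure M A \<le> 2 * exp (- r) * K'"
      using K' by (simp add: exp_minus field_simps)
    then show ?thesis
      using K' by (simp add: emeasure_eq_measure ennreal_mult[symmetric] ennreal_leI flip: ennreal_numeral)
  qed
  then show ?thesis
    unfolding A_def S_def K_def P_def by (simp add: emeasure_eq_measure)
qed

section \<open>From the product to the exponential of the sum\<close>

lemma ereal_exp_ennreal: "0 \<le> t \<Longrightarrow> ereal_exp (enn2ereal (ennreal t)) = ennreal (exp t)"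
  by (simp add: ereal_exp_def)

lemma ereal_exp_mono: "x \<le> y \<Longrightarrow> ereal_exp x \<le> ereal_exp y"
  by (cases x; cases y) (auto simp: ereal_exp_def intro!: ennreal_leI)

lemma ereal_exp_add_ereal: "ereal_exp (ereal s + y) = ennreal (exp s) * ereal_exp y"
  by (cases y) (auto simp: ereal_exp_def exp_add ennreal_mult'' ennreal_mult_top)

lemma prod_one_plus_le_ereal_exp_sum:
  fixes e :: "'i \<Rightarrow> ennreal"
  assumes "finite A"
  shows "(\<Prod>k\<in>A. 1 + e k) \<le> ereal_exp (enn2ereal (\<Sum>k\<in>A. e k))"
proof (cases "(\<Sum>k\<in>A. e k) = top")
  case True
  then show ?thesis by (simp add: ereal_exp_def)
next
  case False
  define t where "t k = enn2real (e k)" for k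
  have e: "e k = ennreal (t k)" "0 \<le> t k" if "k \<in> A" for k
    using False assms that by (auto simp: t_def less_top)
  have "(\<Prod>k\<in>A. 1 + e k) = (\<Prod>k\<in>A. ennreal (1 + t k))"
    using e by (intro prod.cong) (auto simp: ennreal_plus)
  also have "\<dots> = ennreal (\<Prod>k\<in>A. 1 + t k)"
    using e by (intro prod_ennreal) auto
  also have "\<dots> \<le> ennreal (\<Prod>k\<in>A. exp (t k))"
    using e by (intro ennreal_leI prod_mono) auto
  also have "\<dots> = ereal_exp (enn2ereal (ennreal (\<Sum>k\<in>A. t k)))"
    using ereal_exp_ennreal[OF sum_nonneg[OF e(2)], of A] assms by (simp only: exp_sum)
  also have "ennreal (\<Sum>k\<in>A. t k) = (\<Sum>k\<in>A. e k)"
    using e by (subst sum_ennreal[symmetric]) auto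
  finally show ?thesis .
qed

lemma esssup_prod_one_plus_le:
  fixes e :: "'i \<Rightarrow> 'a \<Rightarrow> ennreal"
  assumes A: "finite A" and [measurable]: "\<And>k. k \<in> A \<Longrightarrow> e k \<in> borel_measurable M"
  shows "esssup M (\<lambda>\<omega>. \<Prod>k\<in>A. 1 + e k \<omega>) \<le> ereal_exp (enn2ereal (esssup M (\<lambda>\<omega>. \<Sum>k\<in>A. e k \<omega>)))"
proof (rule esssup_I)
  show "AE \<omega> in M. (\<Prod>k\<in>A. 1 + e k \<omega>) \<le> ereal_exp (enn2ereal (esssup M (\<lambda>\<omega>. \<Sum>k\<in>A. e k \<omega>)))"
    using esssup_AE[of "\<lambda>\<omega>. \<Sum>k\<in>A. e k \<omega>" M]
  proof eventually_elim
    case (elim \<omega>)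
    have "(\<Prod>k\<in>A. 1 + e k \<omega>) \<le> ereal_exp (enn2ereal (\<Sum>k\<in>A. e k \<omega>))"
      using A by (rule prod_one_plus_le_ereal_exp_sum)
    also have "\<dots> \<le> ereal_exp (enn2ereal (esssup M (\<lambda>\<omega>. \<Sum>k\<in>A. e k \<omega>)))"
      using elim by (intro ereal_exp_mono) (simp add: less_eq_ennreal.rep_eq)
    finally show ?case .
  qed
qed measurable

section \<open>The concentration inequality\<close>

theorem proposition4p1:
  fixes M :: "'a measure"
    and F :: "nat \<Rightarrow> 'a measure"
    and \<beta> :: "nat \<Rightarrow> nat \<Rightarrow> 'h \<Rightarrow> 'h::{real_inner, banach, second_countable_topology}"
    and \<xi> :: "nat \<Rightarrow> 'a \<Rightarrow> 'h"
    and \<gamma> :: "nat \<Rightarrow> real"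
    and r :: real and n :: nat
  assumes "prob_space M"
    and "filtration (space M) F"
    and "\<And>i. subalgebra M (F i)"
    and "\<And>i k. bounded_linear (\<beta> i k)"
    and "martingale_difference M F \<xi>"
    and "\<And>i. \<gamma> i > 0"
    and "r > 0"
    and "n \<ge> 1"
  shows
    "ennreal (measure M {\<omega> \<in> space M. norm (\<Sum>k=1..n-1. \<gamma> k *\<^sub>R \<beta> (n-1) k (\<xi> (k+1) \<omega>)) \<ge> r})
       \<le> 2 * ennreal (exp (- r)) *
          esssup M (\<lambda>\<omega>. \<Prod>j=2..n. 1 + cond_exp_excess M (F (j-1))
                        (\<lambda>\<omega>. \<beta> (n-1) (j-1) (\<gamma> (j-1) *\<^sub>R \<xi> j \<omega>)) \<omega>)
     \<and> 2 * ennreal (exp (- r)) *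
          esssup M (\<lambda>\<omega>. \<Prod>j=2..n. 1 + cond_exp_excess M (F (j-1))
                        (\<lambda>\<omega>. \<beta> (n-1) (j-1) (\<gamma> (j-1) *\<^sub>R \<xi> j \<omega>)) \<omega>)
       \<le> 2 * ereal_exp (- ereal r + enn2ereal (
          esssup M (\<lambda>\<omega>. \<Sum>j=2..n. cond_exp_excess M (F (j-1))
                        (\<lambda>\<omega>. \<beta> (n-1) (j-1) (\<gamma> (j-1) *\<^sub>R \<xi> j \<omega>)) \<omega>)))"
proof -
  obtain m where n: "n = Suc m" using \<open>n \<ge> 1\<close> by (cases n) auto
  define L where "L k x = \<beta> m k (\<gamma> k *\<^sub>R x)" for k x
  define d where "d k \<omega> = L k (\<xi> (Suc k) \<omega>)" for k \<omega>
  define e where "e k = cond_exp_excess M (F k) (d k)" for k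
  have \<xi>: "\<xi> k \<in> borel_measurable (F k)" "has_cond_exp M (F k) (\<xi> (Suc k)) (\<lambda>_. 0)" for k
    using assms(5) by (auto simp: martingale_difference_def)
  have L: "bounded_linear (L k)" for k
    unfolding L_def
    by (rule bounded_linear_compose[OF assms(4)]) (rule bounded_linear_scaleR_right)
  have d_meas: "d k \<in> borel_measurable (F (Suc k))" for k
    unfolding d_def
    by (rule measurable_compose[OF \<xi>(1)])
       (intro borel_measurable_continuous_onI linear_continuous_on L)
  have d: "has_cond_exp M (F k) (d k) (\<lambda>_. 0)" for k
    unfolding d_def by (rule has_cond_exp_zero_bounded_linear[OF L \<xi>(2) assms(3)])
  have d_sum: "(\<Sum>k=1..n-1. \<gamma> k *\<^sub>R \<beta> (n-1) k (\<xi> (k+1) \<omega>)) = (\<Sum>k=1..m. d k \<omega>)" for \<omega>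
    by (simp add: n d_def L_def linear_cmul[OF bounded_linear.linear[OF assms(4)]])
  have e_j: "cond_exp_excess M (F (j-1)) (\<lambda>\<omega>. \<beta> (n-1) (j-1) (\<gamma> (j-1) *\<^sub>R \<xi> j \<omega>)) = e (j-1)"
    if "j \<in> {2..n}" for j
    using that by (simp add: n e_def d_def[abs_def] L_def)
  have prod_e: "(\<Prod>j=2..n. 1 + cond_exp_excess M (F (j-1))
        (\<lambda>\<omega>. \<beta> (n-1) (j-1) (\<gamma> (j-1) *\<^sub>R \<xi> j \<omega>)) \<omega>) = (\<Prod>k=1..m. 1 + e k \<omega>)" for \<omega>
  proof -
    have "(\<Prod>j=2..n. 1 + cond_exp_excess M (F (j-1))
        (\<lambda>\<omega>. \<beta> (n-1) (j-1) (\<gamma> (j-1) *\<^sub>R \<xi> j \<omega>)) \<omega>) = (\<Prod>j=2..n. 1 + e (j-1) \<omega>)"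
      by (intro prod.cong refl) (simp only: e_j)
    also have "\<dots> = (\<Prod>k=1..m. 1 + e k \<omega>)"
      using prod.shift_bounds_cl_Suc_ivl[of "\<lambda>j. 1 + e (j-1) \<omega>" 1 m]
      by (simp add: n numeral_2_eq_2 del: prod.cl_ivl_Suc)
    finally show ?thesis .
  qed
  have sum_e: "(\<Sum>j=2..n. cond_exp_excess M (F (j-1))
        (\<lambda>\<omega>. \<beta> (n-1) (j-1) (\<gamma> (j-1) *\<^sub>R \<xi> j \<omega>)) \<omega>) = (\<Sum>k=1..m. e k \<omega>)" for \<omega>
  proof -
    have "(\<Sum>j=2..n. cond_exp_excess M (F (j-1))
        (\<lambda>\<omega>. \<beta> (n-1) (j-1) (\<gamma> (j-1) *\<^sub>R \<xi> j \<omega>)) \<omega>) = (\<Sum>j=2..n. e (j-1) \<omega>)"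
      by (intro sum.cong refl) (simp only: e_j)
    also have "\<dots> = (\<Sum>k=1..m. e k \<omega>)"
      using sum.shift_bounds_cl_Suc_ivl[of "\<lambda>j. e (j-1) \<omega>" 1 m]
      by (simp add: n numeral_2_eq_2 del: sum.cl_ivl_Suc)
    finally show ?thesis .
  qed
  have "ennreal (measure M {\<omega> \<in> space M. r \<le> norm (\<Sum>k=1..m. d k \<omega>)})
      \<le> 2 * ennreal (exp (- r)) * esssup M (\<lambda>\<omega>. \<Prod>k=1..m. 1 + e k \<omega>)"
    unfolding e_def by (rule norm_martingale_tail_le[OF assms(1-3) d_meas d])
  moreover have "2 * ennreal (exp (- r)) * esssup M (\<lambda>\<omega>. \<Prod>k=1..m. 1 + e k \<omega>)
      \<le> 2 * ereal_exp (- ereal r + enn2ereal (esssup M (\<lambda>\<omega>. \<Sum>k=1..m. e k \<omega>)))"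
  proof -
    have e_meas: "e k \<in> borel_measurable M" for k
      unfolding e_def
      by (rule measurable_from_subalg[OF assms(3) cond_exp_excess_measurable])
    have "ereal_exp (- ereal r + y) = ennreal (exp (- r)) * ereal_exp y" for y
      using ereal_exp_add_ereal[of "- r" y] by simp
    then show ?thesis
      using esssup_prod_one_plus_le[of "{1..m}" e M] e_meas
      by (simp add: mult.assoc mult_left_mono)
  qed
  ultimately show ?thesis
    unfolding d_sum prod_e sum_e ..
qed

end
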